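(* Let $\mathcal{A}$ be any deterministic algorithm for the shortest path problem that has a finite approximation ratio. Then $\mathcal{A}$ is not Lipschitz continuous; that is, there is an input graph $G$ (with source $s$ and target $t$) on which the Lipschitz constant of $\mathcal{A}$ is unbounded (infinite).
   Context: Shortest path problem: given an undirected graph $G=(V,E)$ (parallel edges allowed), vertices $s,t\in V$, and a weight vector $w\in\mathbb{R}_{\geq 0}^E$, output an $s$-$t$ path (or walk, regarded as a multiset of edges) $P$ minimizing $\sum_{e\in P}w(e)$ (edges counted with multiplicity). An algorithm has finite approximation ratio $\rho$ if its output always has weight at most $\rho$ times the minimum weight of an $s$-$t$ path. For edge (multi)sets $F,F'$ and weight vectors $w,w'$, define $d_w((F,w),(F',w'))=\bigl\|\sum_{e\in F}w(e)\mathbf{1}_e-\sum_{e\in F'}w'(e)\mathbf{1}_e\bigr\|_1$, where $\mathbf{1}_e\in\mathbb{R}^E$ is the indicator vector of $e$ and elements of a multiset appear in the sum with multiplicity. For a deterministic algorithm $\mathcal{A}$ with output $\mathcal{A}(G,w)$, its Lipschitz constant on $G$ is $\sup_{w\neq w'\in\mathbb{R}_{\geq0}^E} d_w((\mathcal{A}(G,w),w),(\mathcal{A}(G,w'),w'))/\|w-w'\|_1$; $\mathcal{A}$ is Lipschitz continuous if this is finite for every graph $G$. *)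

theory Defs
  imports
    Complex_Main
    "HOL-Library.FuncSet"
    "HOL-Library.Multiset"
    "HOL-Library.Indicator_Function"
    "HOL-Library.Extended_Nonnegative_Real"
    "HOL-Library.Infinite_Typeclass"
begin

record ('v, 'e) multigraph =
  verts :: "'v set"
  edges :: "'e set"
  ends :: "'e \<Rightarrow> 'v set"

text \<open>
  Finite loopless undirected multigraphs: parallel edges are distinct edges with the same set of
  ends. The incidence function is extensional, so that it carries no data outside the edge set.
\<close>

definition wf_multigraph :: "('v, 'e) multigraph \<Rightarrow> bool" where
  "wf_multigraph G \<longleftrightarrow>
     finite (verts G) \<and> finite (edges G) \<and>
     ends G \<in> edges G \<rightarrow>\<^sub>E {U. U \<subseteq> verts G \<and> card U = 2}"

definition is_walk :: "('v, 'e) multigraph \<Rightarrow> 'v \<Rightarrow> 'v \<Rightarrow> 'v list \<Rightarrow> 'e list \<Rightarrow> bool" where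
  "is_walk G s t xs es \<longleftrightarrow>
     length xs = Suc (length es) \<and> hd xs = s \<and> last xs = t \<and>
     set xs \<subseteq> verts G \<and> set es \<subseteq> edges G \<and>
     (\<forall>i<length es. ends G (es ! i) = {xs ! i, xs ! Suc i})"

definition is_path :: "('v, 'e) multigraph \<Rightarrow> 'v \<Rightarrow> 'v \<Rightarrow> 'v list \<Rightarrow> 'e list \<Rightarrow> bool" where
  "is_path G s t xs es \<longleftrightarrow> is_walk G s t xs es \<and> distinct xs"

definition walks :: "('v, 'e) multigraph \<Rightarrow> 'v \<Rightarrow> 'v \<Rightarrow> 'e multiset set" where
  "walks G s t = {mset es | xs es. is_walk G s t xs es}"

definition paths :: "('v, 'e) multigraph \<Rightarrow> 'v \<Rightarrow> 'v \<Rightarrow> 'e multiset set" where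
  "paths G s t = {mset es | xs es. is_path G s t xs es}"

definition sp_instance :: "('v, 'e) multigraph \<Rightarrow> 'v \<Rightarrow> 'v \<Rightarrow> bool" where
  "sp_instance G s t \<longleftrightarrow>
     wf_multigraph G \<and> s \<in> verts G \<and> t \<in> verts G \<and> paths G s t \<noteq> {}"

text \<open>
  Extensional functions, so that distinct elements differ on some edge.
\<close>

definition weights :: "('v, 'e) multigraph \<Rightarrow> ('e \<Rightarrow> real) set" where
  "weights G = edges G \<rightarrow>\<^sub>E {0..}"

definition weight :: "('e \<Rightarrow> real) \<Rightarrow> 'e multiset \<Rightarrow> real" where
  "weight w F = (\<Sum>e\<in>#F. w e)"

definition min_path_weight :: "('v, 'e) multigraph \<Rightarrow> 'v \<Rightarrow> 'v \<Rightarrow> ('e \<Rightarrow> real) \<Rightarrow> real" where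
  "min_path_weight G s t w = Min (weight w ` paths G s t)"

lemma finite_paths:
  assumes "wf_multigraph G"
  shows "finite (paths G s t)"
proof -
  let ?L = "\<lambda>A. {xs. set xs \<subseteq> A \<and> length xs \<le> card (verts G)}"
  have fin: "finite (verts G)" "finite (edges G)"
    using assms by (auto simp: wf_multigraph_def)
  have "paths G s t \<subseteq> mset ` ?L (edges G)"
  proof
    fix F assume "F \<in> paths G s t"
    then obtain xs es where F: "F = mset es" and w: "is_walk G s t xs es" and d: "distinct xs"
      by (auto simp: paths_def is_path_def)
    have "length xs \<le> card (verts G)"
      using w d fin card_mono[of "verts G" "set xs"] by (simp add: is_walk_def distinct_card)
    then show "F \<in> mset ` ?L (edges G)"
      using F w by (auto simp: is_walk_def)
  qed
  then show ?thesis
    using finite_lists_length_le[OF fin(2)] finite_subset by blast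
qed

type_synonym ('v, 'e) algorithm =
  "('v, 'e) multigraph \<Rightarrow> 'v \<Rightarrow> 'v \<Rightarrow> ('e \<Rightarrow> real) \<Rightarrow> 'e multiset"

definition shortest_path_algorithm :: "('v, 'e) algorithm \<Rightarrow> bool" where
  "shortest_path_algorithm \<A> \<longleftrightarrow>
     (\<forall>G s t. sp_instance G s t \<longrightarrow> (\<forall>w\<in>weights G. \<A> G s t w \<in> walks G s t))"

definition has_approximation_ratio :: "('v, 'e) algorithm \<Rightarrow> real \<Rightarrow> bool" where
  "has_approximation_ratio \<A> \<rho> \<longleftrightarrow>
     (\<forall>G s t. sp_instance G s t \<longrightarrow>
        (\<forall>w\<in>weights G. weight w (\<A> G s t w) \<le> \<rho> * min_path_weight G s t w))"

definition l1_norm :: "'e set \<Rightarrow> ('e \<Rightarrow> real) \<Rightarrow> real" where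
  "l1_norm E x = (\<Sum>a\<in>E. \<bar>x a\<bar>)"

definition weighted_vector :: "'e multiset \<Rightarrow> ('e \<Rightarrow> real) \<Rightarrow> 'e \<Rightarrow> real" where
  "weighted_vector F w = (\<lambda>a. \<Sum>e\<in>#F. w e * indicator {e} a)"

definition dist_w ::
  "'e set \<Rightarrow> 'e multiset \<times> ('e \<Rightarrow> real) \<Rightarrow> 'e multiset \<times> ('e \<Rightarrow> real) \<Rightarrow> real" where
  "dist_w E = (\<lambda>(F, w) (F', w'). l1_norm E (\<lambda>a. weighted_vector F w a - weighted_vector F' w' a))"

definition lipschitz_constant ::
  "('v, 'e) algorithm \<Rightarrow> ('v, 'e) multigraph \<Rightarrow> 'v \<Rightarrow> 'v \<Rightarrow> ennreal" where
  "lipschitz_constant \<A> G s t =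
     (SUP (w, w') \<in> {(w, w'). w \<in> weights G \<and> w' \<in> weights G \<and> w \<noteq> w'}.
        ennreal (dist_w (edges G) (\<A> G s t w, w) (\<A> G s t w', w')
                 / l1_norm (edges G) (\<lambda>a. w a - w' a)))"

definition lipschitz_continuous :: "('v, 'e) algorithm \<Rightarrow> bool" where
  "lipschitz_continuous \<A> \<longleftrightarrow>
     (\<forall>G s t. sp_instance G s t \<longrightarrow> lipschitz_constant \<A> G s t < \<infinity>)"

end

theory Submission
  imports Defs "HOL-Analysis.Lipschitz"
begin

text \<open>
  Take two parallel edges \<open>e\<close>, \<open>f\<close> between \<open>s \<noteq> t\<close>, with weights \<open>x\<close> and \<open>1 - x\<close> for
  \<open>0 < x < 1\<close>, and let \<open>m x\<close> be the multiplicity of \<open>e\<close> in the output. A finite Lipschitz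
  constant makes \<open>x \<mapsto> m x * x\<close>, and hence \<open>m\<close>, continuous. The approximation guarantee forces
  \<open>m x = 0\<close> for \<open>x\<close> near 1; for \<open>x\<close> near 0 it forbids \<open>f\<close>, so that \<open>m x \<ge> 1\<close>. By the
  intermediate value theorem the integer \<open>m x\<close> would somewhere equal \<open>1/2\<close>.
\<close>

lemma weighted_vector_eq_count: "weighted_vector F w a = real (count F a) * w a"
  by (induction F) (auto simp: weighted_vector_def indicator_def algebra_simps)

lemma weight_nonneg:
  assumes "\<And>a. a \<in># F \<Longrightarrow> 0 \<le> w a"
  shows "0 \<le> weight w F"
  using assms by (induction F) (auto simp: weight_def)

text \<open>All other summands of \<open>weight w F\<close> are nonnegative. Thus a bound on the
  weight of an output bounds the multiplicity of each single edge.\<close>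

lemma count_mult_le_weight:
  assumes "\<And>a. a \<in># F \<Longrightarrow> 0 \<le> w a"
  shows "real (count F a) * w a \<le> weight w F"
  using assms
proof (induction F)
  case empty
  then show ?case by (simp add: weight_def)
next
  case (add b F)
  then have "real (count F a) * w a \<le> weight w F" "0 \<le> w b" by auto
  then show ?case by (auto simp: weight_def algebra_simps)
qed

lemma walks_subset_edges: "F \<in> walks G s t \<Longrightarrow> set_mset F \<subseteq> edges G"
  by (auto simp: walks_def is_walk_def)

lemma paths_subset_walks: "paths G s t \<subseteq> walks G s t"
  by (auto simp: walks_def paths_def is_path_def)

text \<open>Serves to conclude that an output avoiding one of two edges must use the other.\<close>

lemma empty_notin_walks:
  assumes "s \<noteq> t"
  shows "{#} \<notin> walks G s t"
proof
  assume "{#} \<in> walks G s t"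
  then obtain xs where "length xs = Suc 0" "hd xs = s" "last xs = t"
    by (auto simp: walks_def is_walk_def)
  with assms show False by (cases xs) auto
qed

lemma weights_nonneg: "w \<in> weights G \<Longrightarrow> a \<in> edges G \<Longrightarrow> 0 \<le> w a"
  by (auto simp: weights_def PiE_def Pi_def)

lemma min_path_weight_nonneg:
  assumes "sp_instance G s t" "w \<in> weights G"
  shows "0 \<le> min_path_weight G s t w"
proof -
  have "min_path_weight G s t w \<in> weight w ` paths G s t"
    unfolding min_path_weight_def
    using assms by (intro Min_in) (auto simp: sp_instance_def finite_paths)
  then obtain P where P: "P \<in> paths G s t" "min_path_weight G s t w = weight w P"
    by auto
  have "set_mset P \<subseteq> edges G"
    by (rule walks_subset_edges[OF subsetD[OF paths_subset_walks P(1)]])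
  then show ?thesis
    unfolding P(2) using assms(2) by (intro weight_nonneg) (auto intro: weights_nonneg)
qed

lemma min_path_weight_le:
  assumes "sp_instance G s t" "P \<in> paths G s t"
  shows "min_path_weight G s t w \<le> weight w P"
  unfolding min_path_weight_def
  using assms by (intro Min_le) (auto simp: sp_instance_def finite_paths)

text \<open>Trades the supremum of quotients in \<open>ennreal\<close> for a real inequality without
  division, which also covers \<open>w = w'\<close>.\<close>

lemma lipschitz_constant_finiteE:
  assumes "finite (edges G)" "lipschitz_constant \<A> G s t \<noteq> \<infinity>"
  obtains L where "0 \<le> L"
    "\<And>w w'. w \<in> weights G \<Longrightarrow> w' \<in> weights G \<Longrightarrow>
       dist_w (edges G) (\<A> G s t w, w) (\<A> G s t w', w')
         \<le> L * l1_norm (edges G) (\<lambda>a. w a - w' a)"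
proof -
  obtain L where L: "0 \<le> L" "lipschitz_constant \<A> G s t = ennreal L"
    using assms(2) by (cases "lipschitz_constant \<A> G s t") auto
  have "dist_w (edges G) (\<A> G s t w, w) (\<A> G s t w', w')
          \<le> L * l1_norm (edges G) (\<lambda>a. w a - w' a)"
    if w: "w \<in> weights G" "w' \<in> weights G" for w w'
  proof (cases "w = w'")
    case True
    then show ?thesis by (simp add: dist_w_def l1_norm_def)
  next
    case False
    \<comment> \<open>Weight vectors are extensional, so distinct ones differ on an actual edge and
      the denominator is positive.\<close>
    then obtain a where a: "a \<in> edges G" "w a \<noteq> w' a"
      using w unfolding weights_def by (metis PiE_ext)
    have "0 < l1_norm (edges G) (\<lambda>a. w a - w' a)"
      unfolding l1_norm_def using a assms(1) by (intro sum_pos2[of _ a]) auto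
    moreover have "ennreal (dist_w (edges G) (\<A> G s t w, w) (\<A> G s t w', w')
        / l1_norm (edges G) (\<lambda>a. w a - w' a)) \<le> ennreal L"
      unfolding L(2)[symmetric] lipschitz_constant_def
      using w False by (intro SUP_upper2[of "(w, w')"]) auto
    ultimately show ?thesis
      using L(1) by (simp add: ennreal_le_iff pos_divide_le_eq)
  qed
  with L(1) show ?thesis by (rule that)
qed

text \<open>A single coordinate of a vector is bounded by its l1 norm.\<close>

lemma count_mult_diff_le_dist_w:
  assumes "finite E" "a \<in> E"
  shows "\<bar>real (count F a) * w a - real (count F' a) * w' a\<bar> \<le> dist_w E (F, w) (F', w')"
  unfolding dist_w_def l1_norm_def
  using member_le_sum[of a E "\<lambda>a. \<bar>weighted_vector F w a - weighted_vector F' w' a\<bar>"] assms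
  by (simp add: weighted_vector_eq_count)

definition parallel_edges :: "'v \<Rightarrow> 'v \<Rightarrow> 'e \<Rightarrow> 'e \<Rightarrow> ('v, 'e) multigraph" where
  "parallel_edges s t e f =
     \<lparr>verts = {s, t}, edges = {e, f}, ends = (\<lambda>a\<in>{e, f}. {s, t})\<rparr>"

lemma edges_parallel_edges [simp]: "edges (parallel_edges s t e f) = {e, f}"
  by (simp add: parallel_edges_def)

lemma singleton_mem_paths_parallel_edges:
  assumes "s \<noteq> t" "a \<in> {e, f}"
  shows "{#a#} \<in> paths (parallel_edges s t e f) s t"
proof -
  have "is_path (parallel_edges s t e f) s t [s, t] [a]"
    using assms by (auto simp: is_path_def is_walk_def parallel_edges_def)
  then show ?thesis
    unfolding paths_def by (intro CollectI exI[of _ "[s, t]"] exI[of _ "[a]"]) simp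
qed

lemma sp_instance_parallel_edges:
  assumes "s \<noteq> t"
  shows "sp_instance (parallel_edges s t e f) s t"
  using assms singleton_mem_paths_parallel_edges[OF assms, of e e f]
  by (auto simp: sp_instance_def wf_multigraph_def parallel_edges_def)

lemma lipschitz_constant_parallel_edges:
  assumes alg: "shortest_path_algorithm \<A>" and apx: "has_approximation_ratio \<A> \<rho>"
    and "s \<noteq> t" "e \<noteq> f"
  shows "lipschitz_constant \<A> (parallel_edges s t e f) s t = \<infinity>"
proof (rule ccontr)
  define G where "G = parallel_edges s t e f"
  assume "lipschitz_constant \<A> (parallel_edges s t e f) s t \<noteq> \<infinity>"
  then have fin: "lipschitz_constant \<A> G s t \<noteq> \<infinity>" by (simp add: G_def)
  have edges: "edges G = {e, f}" by (simp add: G_def)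
  have inst: "sp_instance G s t"
    unfolding G_def using assms(3) by (rule sp_instance_parallel_edges)
  have "finite (edges G)" by (simp add: edges)
  then obtain L where L: "0 \<le> L"
    "\<And>w w'. w \<in> weights G \<Longrightarrow> w' \<in> weights G \<Longrightarrow>
       dist_w (edges G) (\<A> G s t w, w) (\<A> G s t w', w')
         \<le> L * l1_norm (edges G) (\<lambda>a. w a - w' a)"
    using fin by (rule lipschitz_constant_finiteE) blast
  \<comment> \<open>The ratio \<open>\<rho>\<close> comes without a sign. Since the minimum path
    weight is nonnegative, it can be enlarged to \<open>R\<close>, which is safe to multiply
    inequalities by.\<close>
  define R where "R = max \<rho> 1"
  have R: "1 \<le> R" "\<rho> \<le> R" by (auto simp: R_def)
  define w where "w x = (\<lambda>a\<in>{e, f}. if a = e then x else 1 - x)" for x :: real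
  have w_e: "w x e = x" and w_f: "w x f = 1 - x" for x
    using \<open>e \<noteq> f\<close> by (auto simp: w_def)
  have w_mem: "w x \<in> weights G" if "x \<in> {0<..<1}" for x
    using that by (auto simp: w_def weights_def edges)
  define F where "F x = \<A> G s t (w x)" for x
  define m where "m x = real (count (F x) e)" for x

  have F_walk: "F x \<in> walks G s t" if "x \<in> {0<..<1}" for x
    using alg inst w_mem[OF that] by (simp add: F_def shortest_path_algorithm_def)
  \<comment> \<open>The path consisting of \<open>b\<close> alone is the competitor of the
    output.\<close>
  have F_apx: "real (count (F x) a) * w x a \<le> R * w x b"
    if x: "x \<in> {0<..<1}" and b: "b \<in> {e, f}" for x a b
  proof -
    have "real (count (F x) a) * w x a \<le> weight (w x) (F x)"
      using walks_subset_edges[OF F_walk[OF x]] weights_nonneg[OF w_mem[OF x]]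
      by (intro count_mult_le_weight) auto
    also have "\<dots> \<le> \<rho> * min_path_weight G s t (w x)"
      using apx inst w_mem[OF x] by (simp add: F_def has_approximation_ratio_def)
    also have "\<dots> \<le> R * min_path_weight G s t (w x)"
      using R(2) min_path_weight_nonneg[OF inst w_mem[OF x]] by (rule mult_right_mono)
    also have "\<dots> \<le> R * weight (w x) {#b#}"
      using R(1) inst singleton_mem_paths_parallel_edges[OF \<open>s \<noteq> t\<close> b]
      by (intro mult_left_mono min_path_weight_le) (auto simp: G_def)
    finally show ?thesis by (simp add: weight_def)
  qed

  \<comment> \<open>The inequality \<open>R * x < 1 - x\<close> means
    \<open>x < 1 / (R + 1)\<close>, which \<open>lo\<close> satisfies; \<open>hi\<close> is the
    mirror image \<open>1 - lo\<close>.\<close>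
  define lo where "lo = 1 / (R + 2)"
  define hi where "hi = (R + 1) / (R + 2)"
  have lo_hi: "0 < lo" "lo \<le> hi" "hi < 1" "R * lo < 1 - lo" "R * (1 - hi) < hi"
    using R(1) by (auto simp: lo_def hi_def field_simps)
  have sub: "{lo..hi} \<subseteq> {0<..<1}" using lo_hi by auto
  \<comment> \<open>Multiplicities are integers: a nonzero one would give
    \<open>u \<le> real (count A a) * u \<le> R * v < u\<close>.\<close>
  have count_0: "count A a = 0" if "real (count A a) * u \<le> R * v" "R * v < u" "0 < v"
    for A :: "'b multiset" and a u v
  proof (rule ccontr)
    assume "count A a \<noteq> 0"
    then have "1 \<le> real (count A a)" by simp
    moreover have "0 < u"
      using that R(1) by (meson le_less_trans less_imp_le mult_nonneg_nonneg order_trans zero_le_one)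
    ultimately have "1 * u \<le> real (count A a) * u" by (intro mult_right_mono) auto
    with that show False by linarith
  qed
  \<comment> \<open>At \<open>hi\<close> one copy of \<open>e\<close> already costs more than
    \<open>R\<close> times the path \<open>f\<close>; at \<open>lo\<close> the roles are
    exchanged.\<close>
  have "count (F hi) e = 0"
    using F_apx[of hi f e] lo_hi by (intro count_0[of _ _ hi "1 - hi"]) (auto simp: w_e w_f)
  then have m_hi: "m hi = 0" by (simp add: m_def)
  have "count (F lo) f = 0"
    using F_apx[of lo e f] lo_hi by (intro count_0[of _ _ "1 - lo" lo]) (auto simp: w_e w_f)
  moreover have "F lo \<noteq> {#}" "set_mset (F lo) \<subseteq> {e, f}"
    using F_walk[of lo] lo_hi empty_notin_walks[OF \<open>s \<noteq> t\<close>, of G]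
      walks_subset_edges[of "F lo" G s t] by (auto simp: edges)
  ultimately have "e \<in># F lo"
    by (metis insert_iff multiset_nonemptyE not_in_iff singletonD subsetD)
  then have m_lo: "1 \<le> m lo" by (simp add: m_def Suc_le_eq)

  have "continuous_on {lo..hi} (\<lambda>x. m x * x)"
  \<comment> \<open>The factor 2 arises because both edge weights change by
    \<open>\<bar>x - y\<bar>\<close>.\<close>
  proof (rule lipschitz_on_continuous_on[of "L * 2"], rule lipschitz_onI)
    fix x y assume "x \<in> {lo..hi}" "y \<in> {lo..hi}"
    then have xy: "w x \<in> weights G" "w y \<in> weights G" using sub w_mem by auto
    have "\<bar>m x * x - m y * y\<bar> \<le> dist_w (edges G) (F x, w x) (F y, w y)"
      using count_mult_diff_le_dist_w[of "edges G" e "F x" "w x" "F y" "w y"]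
      by (simp add: edges m_def w_e)
    also have "\<dots> \<le> L * l1_norm (edges G) (\<lambda>a. w x a - w y a)"
      unfolding F_def using L(2) xy by blast
    also have "l1_norm (edges G) (\<lambda>a. w x a - w y a) = 2 * \<bar>x - y\<bar>"
      using \<open>e \<noteq> f\<close> by (simp add: l1_norm_def edges w_e w_f)
    finally show "dist (m x * x) (m y * y) \<le> L * 2 * dist x y" by (simp add: dist_real_def)
  qed (use L(1) in simp)
  \<comment> \<open>Dividing by \<open>x\<close> is harmless, as \<open>lo > 0\<close> keeps the
    interval away from 0.\<close>
  then have "continuous_on {lo..hi} (\<lambda>x. m x * x / x)"
    using lo_hi(1) by (intro continuous_on_divide continuous_on_id) auto
  then have "continuous_on {lo..hi} m"
    by (rule continuous_on_eq) (use lo_hi(1) in auto)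
  \<comment> \<open>This is the intermediate value theorem for descending values:
    \<open>m lo \<ge> 1\<close> and \<open>m hi = 0\<close>.\<close>
  then obtain z where "m z = 1 / 2"
    using IVT2'[of m hi "1 / 2" lo] m_hi m_lo lo_hi(2) by auto
  then have "real (2 * count (F z) e) = real 1" by (simp add: m_def)
  then have "2 * count (F z) e = 1" unfolding of_nat_eq_iff .
  then show False by presburger
qed

theorem theorem1p2:
  fixes \<A> :: "('v::infinite, 'e::infinite) algorithm"
  assumes "shortest_path_algorithm \<A>"
    and "\<exists>\<rho>. has_approximation_ratio \<A> \<rho>"
  shows "\<not> lipschitz_continuous \<A> \<and>
    (\<exists>G s t. sp_instance G s t \<and> lipschitz_constant \<A> G s t = \<infinity>)"
proof -
  \<comment> \<open>Here \<open>undefined\<close> is just some element; an infinite type contains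
    another one.\<close>
  obtain s t :: 'v where "s \<noteq> t"
    using ex_new_if_finite[OF infinite_UNIV, of "{undefined}"] by auto
  moreover obtain e f :: 'e where "e \<noteq> f"
    using ex_new_if_finite[OF infinite_UNIV, of "{undefined}"] by auto
  ultimately have "\<exists>G s t. sp_instance G s t \<and> lipschitz_constant \<A> G s t = \<infinity>"
    using assms sp_instance_parallel_edges lipschitz_constant_parallel_edges by metis
  then show ?thesis unfolding lipschitz_continuous_def by (metis less_irrefl)
qed

end
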